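(* Let $k\ge 2$ and $n$ be positive integers with $\log_2 n\ge k$. Then the integrality gap of \textsc{Mono-LP-Rel} on instances with ground set of size $n$ and $k$ functions is at least $\frac{k}{2}-\frac{k(k-1)}{\log_2 n}$.
   Context: An instance consists of a finite set $N$ with $|N|=n$ and monotone submodular functions $f_1,\ldots,f_k:2^N\to\mathbb{R}_+$ with $f_i(\emptyset)=0$ ($f$ is submodular if $f(S)+f(T)\ge f(S\cup T)+f(S\cap T)$ for all $S,T$, monotone if $S\subseteq T$ implies $f(S)\le f(T)$). Write $[k]=\{1,\ldots,k\}$, $\chi_S$ for the characteristic vector of $S\subseteq N$ and $\mathbf{1}$ for the all-ones vector in $\mathbb{R}^N$. \textsc{Mono-LP-Rel} is the linear program: minimize $\sum_{S\subseteq N,\,i\in[k]} y_i(S) f_i(S)$ subject to $y_i\in\mathbb{R}_+^{2^N}$ for all $i$ and $\sum_{S\subseteq N,\,i\in[k]} y_i(S)\chi_S=\mathbf{1}$. For an instance let $\mathrm{OPT}=\min\{\sum_{i=1}^k f_i(X_i)\mid X_1,\ldots,X_k \text{ a partition of } N \text{ (parts possibly empty)}\}$ and $\mathrm{OPT}_{LP}$ the optimal LP value. The integrality gap is the supremum over instances of $\mathrm{OPT}/\mathrm{OPT}_{LP}$ (with the ratio taken as $+\infty$ if $\mathrm{OPT}_{LP}=0<\mathrm{OPT}$ and as $1$ if both are $0$). *)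

theory Defs
  imports Complex_Main "HOL-Library.Extended_Real" "HOL-Library.Disjoint_Sets"
    "HOL-Library.Indicator_Function"
begin

definition submodular_on :: "'a set \<Rightarrow> ('a set \<Rightarrow> real) \<Rightarrow> bool" where
  "submodular_on N f \<longleftrightarrow>
     (\<forall>S T. S \<subseteq> N \<longrightarrow> T \<subseteq> N \<longrightarrow> f S + f T \<ge> f (S \<union> T) + f (S \<inter> T))"

definition mono_instance :: "'a set \<Rightarrow> nat \<Rightarrow> (nat \<Rightarrow> 'a set \<Rightarrow> real) \<Rightarrow> bool" where
  "mono_instance N k f \<longleftrightarrow> finite N \<and>
     (\<forall>i\<in>{1..k}. (\<forall>S\<in>Pow N. f i S \<ge> 0) \<and> f i {} = 0 \<and>
        mono_on (Pow N) (f i) \<and> submodular_on N (f i))"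

definition lp_feasible :: "'a set \<Rightarrow> nat \<Rightarrow> (nat \<Rightarrow> 'a set \<Rightarrow> real) \<Rightarrow> bool" where
  "lp_feasible N k y \<longleftrightarrow>
     (\<forall>i\<in>{1..k}. \<forall>S\<in>Pow N. y i S \<ge> 0) \<and>
     (\<forall>v\<in>N. (\<Sum>i\<in>{1..k}. \<Sum>S\<in>Pow N. y i S * indicator S v) = 1)"

definition lp_cost ::
  "'a set \<Rightarrow> nat \<Rightarrow> (nat \<Rightarrow> 'a set \<Rightarrow> real) \<Rightarrow> (nat \<Rightarrow> 'a set \<Rightarrow> real) \<Rightarrow> real" where
  "lp_cost N k f y = (\<Sum>i\<in>{1..k}. \<Sum>S\<in>Pow N. y i S * f i S)"

definition opt_lp :: "'a set \<Rightarrow> nat \<Rightarrow> (nat \<Rightarrow> 'a set \<Rightarrow> real) \<Rightarrow> real" where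
  "opt_lp N k f = (INF y\<in>{y. lp_feasible N k y}. lp_cost N k f y)"

(* Parts are indexed by 1, ..., k and may be empty; the values of X outside {1..k} are irrelevant. *)
definition is_allocation :: "'a set \<Rightarrow> nat \<Rightarrow> (nat \<Rightarrow> 'a set) \<Rightarrow> bool" where
  "is_allocation N k X \<longleftrightarrow> (\<Union>i\<in>{1..k}. X i) = N \<and> disjoint_family_on X {1..k}"

definition opt_int :: "'a set \<Rightarrow> nat \<Rightarrow> (nat \<Rightarrow> 'a set \<Rightarrow> real) \<Rightarrow> real" where
  "opt_int N k f = Min {(\<Sum>i\<in>{1..k}. f i (X i)) | X. is_allocation N k X}"

definition gap_ratio :: "'a set \<Rightarrow> nat \<Rightarrow> (nat \<Rightarrow> 'a set \<Rightarrow> real) \<Rightarrow> ereal" where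
  "gap_ratio N k f =
     (if opt_lp N k f = 0 then (if opt_int N k f = 0 then 1 else \<infinity>)
      else ereal (opt_int N k f / opt_lp N k f))"

(* Every finite ground set is in bijection with a set of naturals, so ranging over all
   N :: nat set with n elements accounts for all instances up to relabelling. *)
definition integrality_gap :: "nat \<Rightarrow> nat \<Rightarrow> ereal" where
  "integrality_gap n k =
     Sup {gap_ratio N k f | (N :: nat set) f. card N = n \<and> mono_instance N k f}"

end

theory Submission
  imports Defs
begin

text \<open>
  Vertex cover in a weighted \<open>k\<close>-partite hypergraph. Part \<open>i\<close> has vertices \<open>0, \<dots>, m\<close>, where
  vertex \<open>0\<close> is prohibitively heavy and the others have weight \<open>1\<close>; the hyperedges are the tuples
  \<open>e\<close> with \<open>e\<^sub>1 + \<dots> + e\<^sub>k \<ge> s\<close>. The ground set consists of hyperedges, and \<open>f\<^sub>i S\<close> is the weight of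
  the set of vertices of part \<open>i\<close> that lie on hyperedges in \<open>S\<close>, so an allocation is a vertex cover.
  A vertex cover that avoids all vertices \<open>0\<close> misses in each part some vertex \<open>a\<^sub>i\<close> with \<open>m - a\<^sub>i\<close> at
  most the number of chosen vertices; since \<open>a\<close> is not a hyperedge, the cover costs more than
  \<open>k * m - s\<close>. Fractionally, the level sets \<open>{e. e\<^sub>i \<ge> j}\<close>, each taken to the extent \<open>1 / s\<close>, cover
  every hyperedge at total cost \<open>k * m * (m + 1) / (2 * s)\<close>. With \<open>s\<close> about \<open>k * m / 2\<close> the ratio is
  about \<open>k / 2\<close>, and there are at most \<open>(m + 1) ^ k \<le> 2 ^ (m * k)\<close> hyperedges.
\<close>

lemma lp_cost_nonneg:
  assumes "mono_instance N k f" "lp_feasible N k y"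
  shows "lp_cost N k f y \<ge> 0"
  using assms unfolding lp_cost_def mono_instance_def lp_feasible_def
  by (intro sum_nonneg mult_nonneg_nonneg) auto

lemma opt_lp_le_lp_cost:
  assumes "mono_instance N k f" "lp_feasible N k y"
  shows "opt_lp N k f \<le> lp_cost N k f y"
  unfolding opt_lp_def using assms lp_cost_nonneg[OF assms(1)]
  by (intro cINF_lower bdd_belowI2[where m = 0]) auto

definition multicover_weights ::
  "'t set \<Rightarrow> ('t \<Rightarrow> nat) \<Rightarrow> ('t \<Rightarrow> 'a set) \<Rightarrow> nat \<Rightarrow> nat \<Rightarrow> 'a set \<Rightarrow> real" where
  "multicover_weights T part K s i S = real (card {t\<in>T. part t = i \<and> K t = S}) / real s"

lemma sum_multicover_weights:
  assumes "finite N" "finite T" "part ` T \<subseteq> {1..k}" "K ` T \<subseteq> Pow N"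
  shows "(\<Sum>i\<in>{1..k}. \<Sum>S\<in>Pow N. multicover_weights T part K s i S * h i S)
    = (\<Sum>t\<in>T. h (part t) (K t)) / real s"
proof -
  let ?fibre = "\<lambda>p. {t\<in>T. (part t, K t) = p}"
  have "(\<Sum>t\<in>T. h (part t) (K t))
      = (\<Sum>p\<in>{1..k} \<times> Pow N. \<Sum>t\<in>?fibre p. h (part t) (K t))"
    using assms by (intro sum.group[symmetric]) auto
  also have "\<dots> = (\<Sum>(i, S)\<in>{1..k} \<times> Pow N. real (card (?fibre (i, S))) * h i S)"
    by (intro sum.cong) auto
  also have "\<dots> = (\<Sum>i\<in>{1..k}. \<Sum>S\<in>Pow N. real (card (?fibre (i, S))) * h i S)"
    by (rule sum.cartesian_product[symmetric])
  finally show ?thesis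
    by (simp add: multicover_weights_def sum_divide_distrib)
qed

lemma lp_cost_multicover_weights:
  assumes "finite N" "finite T" "part ` T \<subseteq> {1..k}" "K ` T \<subseteq> Pow N"
  shows "lp_cost N k f (multicover_weights T part K s) = (\<Sum>t\<in>T. f (part t) (K t)) / real s"
  unfolding lp_cost_def using assms by (rule sum_multicover_weights)

lemma lp_feasible_multicover_weights:
  assumes family: "finite N" "finite T" "part ` T \<subseteq> {1..k}" "K ` T \<subseteq> Pow N"
    and "s > 0" and cover: "\<And>v. v \<in> N \<Longrightarrow> card {t\<in>T. v \<in> K t} = s"
  shows "lp_feasible N k (multicover_weights T part K s)"
  unfolding lp_feasible_def
proof (intro conjI ballI)
  fix v assume "v \<in> N"
  have "(\<Sum>t\<in>T. indicator (K t) v) = real (card {t\<in>T. v \<in> K t})"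
    using \<open>finite T\<close> by (simp add: indicator_def sum.If_cases Int_def)
  then show "(\<Sum>i\<in>{1..k}. \<Sum>S\<in>Pow N. multicover_weights T part K s i S * indicator S v) = 1"
    unfolding sum_multicover_weights[OF family, where h = "\<lambda>_ S. indicator S v"]
    using \<open>s > 0\<close> cover[OF \<open>v \<in> N\<close>] by simp
qed (simp add: multicover_weights_def)

lemma opt_lp_nonneg:
  assumes "mono_instance N k f" "k \<ge> 1"
  shows "opt_lp N k f \<ge> 0"
proof -
  have "lp_feasible N k (multicover_weights {()} (\<lambda>_. 1) (\<lambda>_. N) 1)"
    using assms by (intro lp_feasible_multicover_weights) (auto simp: mono_instance_def)
  then show ?thesis
    unfolding opt_lp_def using lp_cost_nonneg[OF assms(1)] by (intro cINF_greatest) auto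
qed

lemma opt_lp_le_multicover:
  assumes inst: "mono_instance N k f"
    and family: "finite T" "part ` T \<subseteq> {1..k}" "K ` T \<subseteq> Pow N"
    and "s > 0" and cover: "\<And>v. v \<in> N \<Longrightarrow> s \<le> card {t\<in>T. v \<in> K t}"
  shows "opt_lp N k f \<le> (\<Sum>t\<in>T. f (part t) (K t)) / real s"
proof -
  \<comment> \<open>The LP asks for equality, so each element is removed from all but \<open>s\<close> of its sets.\<close>
  have "\<forall>v\<in>N. \<exists>R \<subseteq> {t\<in>T. v \<in> K t}. card R = s"
    using cover by (meson obtain_subset_with_card_n)
  then obtain R where R_subset: "\<And>v. v \<in> N \<Longrightarrow> R v \<subseteq> {t\<in>T. v \<in> K t}"
    and card_R: "\<And>v. v \<in> N \<Longrightarrow> card (R v) = s"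
    by metis
  define L where "L t = {v\<in>N. t \<in> R v}" for t
  have L_subset: "L t \<subseteq> K t" for t
    using R_subset by (auto simp: L_def)
  have finN: "finite N" and mono: "\<And>i. i \<in> {1..k} \<Longrightarrow> mono_on (Pow N) (f i)"
    using inst by (auto simp: mono_instance_def)
  have L_family: "L ` T \<subseteq> Pow N" by (auto simp: L_def)
  have "{t\<in>T. v \<in> L t} = R v" if "v \<in> N" for v
    using R_subset[OF that] that by (auto simp: L_def)
  then have "lp_feasible N k (multicover_weights T part L s)"
    using finN family L_family \<open>s > 0\<close> card_R by (intro lp_feasible_multicover_weights) auto
  then have "opt_lp N k f \<le> lp_cost N k f (multicover_weights T part L s)"
    by (rule opt_lp_le_lp_cost[OF inst])
  also have "\<dots> = (\<Sum>t\<in>T. f (part t) (L t)) / real s"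
    using finN family(1,2) L_family by (rule lp_cost_multicover_weights)
  also have "\<dots> \<le> (\<Sum>t\<in>T. f (part t) (K t)) / real s"
    using family L_family L_subset
    by (intro divide_right_mono sum_mono mono_onD[OF mono]) auto
  finally show ?thesis .
qed

lemma finite_allocation_costs:
  assumes "finite N"
  shows "finite {(\<Sum>i\<in>{1..k}. f i (X i)) | X. is_allocation N k X}"
proof (rule finite_subset)
  let ?cost = "\<lambda>X. \<Sum>i\<in>{1..k}. f i (X i)"
  show "{?cost X | X. is_allocation N k X} \<subseteq> ?cost ` PiE {1..k} (\<lambda>_. Pow N)"
  proof safe
    fix X assume "is_allocation N k X"
    then have "restrict X {1..k} \<in> PiE {1..k} (\<lambda>_. Pow N)"
      by (auto simp: is_allocation_def)
    then show "?cost X \<in> ?cost ` PiE {1..k} (\<lambda>_. Pow N)"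
      by (intro image_eqI[of _ _ "restrict X {1..k}"]) auto
  qed
  show "finite (?cost ` PiE {1..k} (\<lambda>_. Pow N))"
    using assms by (intro finite_imageI finite_PiE) auto
qed

lemma is_allocation_single:
  assumes "i \<in> {1..k}"
  shows "is_allocation N k ((\<lambda>_. {})(i := N))"
  using assms by (auto simp: is_allocation_def disjoint_family_on_def split: if_splits)

lemma le_opt_int:
  assumes "finite N" "k \<ge> 1"
    and bound: "\<And>X. is_allocation N k X \<Longrightarrow> a \<le> (\<Sum>i\<in>{1..k}. f i (X i))"
  shows "a \<le> opt_int N k f"
proof -
  have "{(\<Sum>i\<in>{1..k}. f i (X i)) | X. is_allocation N k X} \<noteq> {}"
    using is_allocation_single[of 1 k N] \<open>k \<ge> 1\<close> by auto
  then show ?thesis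
    unfolding opt_int_def using finite_allocation_costs[OF \<open>finite N\<close>] bound
    by (subst Min_ge_iff) auto
qed

lemma gap_ratio_ge:
  assumes inst: "mono_instance N k f" and "k \<ge> 1"
    and lp: "opt_lp N k f \<le> b" and int: "a \<le> opt_int N k f" and "a > 0"
  shows "gap_ratio N k f \<ge> ereal (a / b)"
proof (cases "opt_lp N k f = 0")
  case True
  then show ?thesis using int \<open>a > 0\<close> by (simp add: gap_ratio_def)
next
  case False
  then have "opt_lp N k f > 0" using opt_lp_nonneg[OF inst \<open>k \<ge> 1\<close>] by simp
  then have "a / b \<le> opt_int N k f / opt_lp N k f"
    using lp int \<open>a > 0\<close> by (intro frac_le) auto
  then show ?thesis using False by (simp add: gap_ratio_def)
qed

lemma gap_ratio_le_integrality_gap: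
  fixes N :: "nat set"
  assumes "mono_instance N k f" "card N = n"
  shows "gap_ratio N k f \<le> integrality_gap n k"
  unfolding integrality_gap_def using assms by (intro Sup_upper) blast

definition image_weight :: "('b \<Rightarrow> real) \<Rightarrow> ('a \<Rightarrow> 'b) \<Rightarrow> 'a set \<Rightarrow> real" where
  "image_weight w p S = sum w (p ` S)"

lemma mono_on_image_weight:
  assumes "finite N" "\<And>x. w x \<ge> 0"
  shows "mono_on (Pow N) (image_weight w p)"
  unfolding image_weight_def using assms
  by (intro mono_onI sum_mono2) (auto intro: finite_subset)

lemma submodular_on_image_weight:
  assumes "finite N" and nonneg: "\<And>x. w x \<ge> 0"
  shows "submodular_on N (image_weight w p)"
  unfolding submodular_on_def
proof (intro allI impI)
  fix S T assume "S \<subseteq> N" "T \<subseteq> N"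
  then have fin: "finite S" "finite T" using \<open>finite N\<close> finite_subset by blast+
  have "sum w (p ` (S \<inter> T)) \<le> sum w (p ` S \<inter> p ` T)"
    using fin nonneg by (intro sum_mono2) auto
  moreover have "sum w (p ` S \<union> p ` T) + sum w (p ` S \<inter> p ` T) = sum w (p ` S) + sum w (p ` T)"
    using fin by (intro sum.union_inter) auto
  ultimately show "image_weight w p S + image_weight w p T
      \<ge> image_weight w p (S \<union> T) + image_weight w p (S \<inter> T)"
    by (simp add: image_weight_def image_Un)
qed

lemma mono_instance_image_weight:
  assumes "finite N" "\<And>i x. w i x \<ge> 0"
  shows "mono_instance N k (\<lambda>i. image_weight (w i) (p i))"
  unfolding mono_instance_def
  using assms mono_on_image_weight[OF assms] submodular_on_image_weight[OF assms]
  by (auto simp: image_weight_def intro: sum_nonneg)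

definition is_vertex_cover :: "nat \<Rightarrow> (nat \<Rightarrow> 'b) set \<Rightarrow> (nat \<Rightarrow> 'b set) \<Rightarrow> bool" where
  "is_vertex_cover k E C \<longleftrightarrow> (\<forall>e\<in>E. \<exists>i\<in>{1..k}. e i \<in> C i)"

lemma is_vertex_cover_of_allocation:
  assumes "is_allocation N k X"
  shows "is_vertex_cover k (g ` N) (\<lambda>i. (\<lambda>v. g v i) ` X i)"
  using assms by (fastforce simp: is_vertex_cover_def is_allocation_def)

definition threshold_edges :: "nat \<Rightarrow> nat \<Rightarrow> nat \<Rightarrow> (nat \<Rightarrow> nat) set" where
  "threshold_edges k m s = {e \<in> PiE {1..k} (\<lambda>_. {0..m}). s \<le> (\<Sum>i\<in>{1..k}. e i)}"

lemma finite_threshold_edges: "finite (threshold_edges k m s)"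
  unfolding threshold_edges_def by (simp add: finite_PiE)

lemma card_threshold_edges_le: "card (threshold_edges k m s) \<le> (m + 1) ^ k"
proof -
  have "card (threshold_edges k m s) \<le> card (PiE {1..k} (\<lambda>_. {0..m}))"
    unfolding threshold_edges_def by (intro card_mono finite_PiE) auto
  also have "\<dots> = (m + 1) ^ k" by (simp add: card_PiE)
  finally show ?thesis .
qed

lemma threshold_edges_nonempty:
  assumes "s \<le> k * m"
  shows "threshold_edges k m s \<noteq> {}"
proof -
  have "restrict (\<lambda>_. m) {1..k} \<in> threshold_edges k m s"
    using assms by (auto simp: threshold_edges_def)
  then show ?thesis by blast
qed

lemma ex_enumeration_threshold_edges:
  assumes "s \<le> k * m" "(m + 1) ^ k \<le> n"
  shows "\<exists>g. g ` {..<n} = threshold_edges k m s"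
proof -
  have "card (threshold_edges k m s) \<le> card {..<n}"
    using card_threshold_edges_le[of k m s] assms(2) by simp
  then have "\<exists>h. inj_on h (threshold_edges k m s) \<and> h ` threshold_edges k m s \<subseteq> {..<n}"
    using finite_threshold_edges by (simp add: inj_on_iff_card_le)
  then show ?thesis
    using inj_on_iff_surj[OF threshold_edges_nonempty[OF assms(1)]] by blast
qed

lemma ex_nonmember_ge_diff_card:
  fixes C :: "nat set"
  assumes "finite C" "0 \<notin> C"
  shows "\<exists>a\<in>{m - card C..m}. a \<notin> C"
proof (rule ccontr)
  assume "\<not> ?thesis"
  then have sub: "{m - card C..m} \<subseteq> C" by blast
  then have "m - card C \<noteq> 0" using \<open>0 \<notin> C\<close> by auto
  moreover have "card {m - card C..m} \<le> card C" using \<open>finite C\<close> sub by (rule card_mono)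
  ultimately show False by simp
qed

lemma card_vertex_cover_threshold_edges:
  assumes cover: "is_vertex_cover k (threshold_edges k m s) C"
    and light: "\<And>i. i \<in> {1..k} \<Longrightarrow> finite (C i)" "\<And>i. i \<in> {1..k} \<Longrightarrow> 0 \<notin> C i"
  shows "k * m < s + (\<Sum>i\<in>{1..k}. card (C i))"
proof -
  have "\<forall>i\<in>{1..k}. \<exists>a. a \<in> {m - card (C i)..m} \<and> a \<notin> C i"
    using ex_nonmember_ge_diff_card light by blast
  then obtain a where a_ge: "\<And>i. i \<in> {1..k} \<Longrightarrow> a i \<in> {m - card (C i)..m}"
    and a_uncovered: "\<And>i. i \<in> {1..k} \<Longrightarrow> a i \<notin> C i"
    by metis
  have "restrict a {1..k} \<notin> threshold_edges k m s"
    using cover a_uncovered by (auto simp: is_vertex_cover_def)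
  then have "(\<Sum>i\<in>{1..k}. a i) < s"
    using a_ge by (auto simp: threshold_edges_def not_le)
  moreover have "(\<Sum>i\<in>{1..k}. m) \<le> (\<Sum>i\<in>{1..k}. a i + card (C i))"
    using a_ge by (intro sum_mono) fastforce
  ultimately show ?thesis by (simp add: sum.distrib)
qed

definition vertex_weight :: "nat \<Rightarrow> nat \<Rightarrow> nat \<Rightarrow> real" where
  "vertex_weight k m j = (if j = 0 then real (k * m) + 1 else 1)"

lemma vertex_weight_nonneg: "vertex_weight k m j \<ge> 0"
  by (simp add: vertex_weight_def)

lemma sum_vertex_weight:
  assumes "0 \<notin> A"
  shows "sum (vertex_weight k m) A = real (card A)"
proof -
  have "sum (vertex_weight k m) A = (\<Sum>j\<in>A. 1)"
    using assms by (intro sum.cong) (auto simp: vertex_weight_def)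
  then show ?thesis by simp
qed

lemma weight_vertex_cover_threshold_edges:
  assumes cover: "is_vertex_cover k (threshold_edges k m s) C"
    and fin: "\<And>i. i \<in> {1..k} \<Longrightarrow> finite (C i)"
  shows "real (k * m) + 1 - real s \<le> (\<Sum>i\<in>{1..k}. sum (vertex_weight k m) (C i))"
proof (cases "\<exists>i\<in>{1..k}. 0 \<in> C i")
  case True
  then obtain i where heavy: "i \<in> {1..k}" "0 \<in> C i" by blast
  have "real (k * m) + 1 = vertex_weight k m 0" by (simp add: vertex_weight_def)
  also have "\<dots> \<le> sum (vertex_weight k m) (C i)"
    using fin heavy vertex_weight_nonneg by (intro member_le_sum) auto
  also have "\<dots> \<le> (\<Sum>i\<in>{1..k}. sum (vertex_weight k m) (C i))"
    using heavy(1) vertex_weight_nonneg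
    by (intro member_le_sum[where f = "\<lambda>i. sum (vertex_weight k m) (C i)"] sum_nonneg) auto
  finally show ?thesis by linarith
next
  case False
  then have "k * m < s + (\<Sum>i\<in>{1..k}. card (C i))"
    using fin by (intro card_vertex_cover_threshold_edges[OF cover]) auto
  then have "real (k * m) + 1 \<le> real s + (\<Sum>i\<in>{1..k}. real (card (C i)))"
    unfolding of_nat_sum[symmetric] by linarith
  then show ?thesis using False by (simp add: sum_vertex_weight)
qed

definition cover_cost :: "nat \<Rightarrow> nat \<Rightarrow> ('a \<Rightarrow> nat \<Rightarrow> nat) \<Rightarrow> nat \<Rightarrow> 'a set \<Rightarrow> real" where
  "cover_cost k m g i = image_weight (vertex_weight k m) (\<lambda>v. g v i)"

lemma mono_instance_cover_cost:
  assumes "finite N"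
  shows "mono_instance N k (cover_cost k m g)"
  unfolding cover_cost_def using assms vertex_weight_nonneg by (rule mono_instance_image_weight)

lemma opt_int_cover_cost_ge:
  assumes "finite N" "k \<ge> 1" and edges: "g ` N = threshold_edges k m s"
  shows "real (k * m) + 1 - real s \<le> opt_int N k (cover_cost k m g)"
proof (rule le_opt_int[OF assms(1,2)])
  fix X assume alloc: "is_allocation N k X"
  then have "finite (X i)" if "i \<in> {1..k}" for i
    using that \<open>finite N\<close> by (auto simp: is_allocation_def intro: finite_subset)
  then show "real (k * m) + 1 - real s \<le> (\<Sum>i\<in>{1..k}. cover_cost k m g i (X i))"
    unfolding cover_cost_def image_weight_def
    using is_vertex_cover_of_allocation[OF alloc, of g]
    by (intro weight_vertex_cover_threshold_edges) (auto simp: edges)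
qed

definition level_set :: "'a set \<Rightarrow> ('a \<Rightarrow> nat \<Rightarrow> nat) \<Rightarrow> nat \<Rightarrow> nat \<Rightarrow> 'a set" where
  "level_set N g i j = {v\<in>N. j \<le> g v i}"

lemma cover_cost_level_set_le:
  assumes "j \<ge> 1" "\<And>v. v \<in> N \<Longrightarrow> g v i \<le> m"
  shows "cover_cost k m g i (level_set N g i j) \<le> real (m + 1 - j)"
proof -
  have "cover_cost k m g i (level_set N g i j) \<le> sum (vertex_weight k m) {j..m}"
    unfolding cover_cost_def image_weight_def level_set_def
    using assms(2) vertex_weight_nonneg by (intro sum_mono2) auto
  also have "\<dots> = real (m + 1 - j)" using assms(1) by (simp add: sum_vertex_weight)
  finally show ?thesis .
qed

lemma sum_add_one_diff_Gauss: "(\<Sum>j=1..m. real (m + 1 - j)) = real m * (real m + 1) / 2"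
proof -
  have "(\<Sum>j=1..m. real (m + 1 - j)) = (\<Sum>j=1..m. real j)"
    by (rule sum.atLeastAtMost_rev[symmetric])
  then show ?thesis using double_gauss_sum_from_Suc_0[of m, where 'a = real] by simp
qed

lemma card_level_sets_containing:
  assumes "v \<in> N" "\<And>i. i \<in> {1..k} \<Longrightarrow> g v i \<le> m"
  shows "card {t\<in>{1..k} \<times> {1..m}. v \<in> level_set N g (fst t) (snd t)} = (\<Sum>i\<in>{1..k}. g v i)"
proof -
  have "{t\<in>{1..k} \<times> {1..m}. v \<in> level_set N g (fst t) (snd t)} = (SIGMA i:{1..k}. {1..g v i})"
    using assms by (fastforce simp: level_set_def)
  then show ?thesis by simp
qed

lemma opt_lp_cover_cost_le:
  assumes "finite N" "s > 0" and edges: "g ` N \<subseteq> threshold_edges k m s"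
  shows "opt_lp N k (cover_cost k m g) \<le> real (k * m) * (real m + 1) / (2 * real s)"
proof -
  let ?T = "{1..k} \<times> {1..m}"
  let ?level = "\<lambda>t. level_set N g (fst t) (snd t)"
  have edge_bounds: "s \<le> (\<Sum>i\<in>{1..k}. g v i)" "\<And>i. i \<in> {1..k} \<Longrightarrow> g v i \<le> m" if "v \<in> N" for v
  proof -
    have "g v \<in> threshold_edges k m s" using edges that by blast
    then show "s \<le> (\<Sum>i\<in>{1..k}. g v i)" "\<And>i. i \<in> {1..k} \<Longrightarrow> g v i \<le> m"
      by (auto simp: threshold_edges_def PiE_iff)
  qed
  have "s \<le> card {t\<in>?T. v \<in> ?level t}" if "v \<in> N" for v
    using card_level_sets_containing[of v N k g m] edge_bounds that by simp
  then have "opt_lp N k (cover_cost k m g)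
      \<le> (\<Sum>t\<in>?T. cover_cost k m g (fst t) (?level t)) / real s"
    using assms(1,2)
    by (intro opt_lp_le_multicover mono_instance_cover_cost) (auto simp: level_set_def)
  also have "\<dots> \<le> (\<Sum>t\<in>?T. real (m + 1 - snd t)) / real s"
    using edge_bounds(2) by (intro divide_right_mono sum_mono cover_cost_level_set_le) auto
  also have "(\<Sum>t\<in>?T. real (m + 1 - snd t)) = (\<Sum>i=1..k. \<Sum>j=1..m. real (m + 1 - j))"
    by (simp only: sum.cartesian_product case_prod_unfold)
  also have "\<dots> = real (k * m) * (real m + 1) / 2"
    unfolding sum_add_one_diff_Gauss by simp
  finally show ?thesis by simp
qed

lemma integrality_gap_ge_threshold:
  assumes "s > 0" "s \<le> k * m" "(m + 1) ^ k \<le> n"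
  shows "integrality_gap n k
    \<ge> ereal (2 * real s * (real (k * m) + 1 - real s) / (real (k * m) * (real m + 1)))"
proof -
  obtain g where g_image: "g ` {..<n} = threshold_edges k m s"
    using ex_enumeration_threshold_edges[OF assms(2,3)] by blast
  have "k \<ge> 1" using assms(1,2) by (cases k) auto
  have inst: "mono_instance {..<n} k (cover_cost k m g)"
    by (simp add: mono_instance_cover_cost)
  have "real s \<le> real (k * m)" using assms(2) by (rule of_nat_mono)
  then have "ereal ((real (k * m) + 1 - real s) / (real (k * m) * (real m + 1) / (2 * real s)))
      \<le> gap_ratio {..<n} k (cover_cost k m g)"
    using g_image \<open>k \<ge> 1\<close> \<open>s > 0\<close>
    by (intro gap_ratio_ge[OF inst] opt_lp_cover_cost_le opt_int_cover_cost_ge) auto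
  also have "\<dots> \<le> integrality_gap n k"
    using inst by (rule gap_ratio_le_integrality_gap) simp
  finally show ?thesis by (simp add: mult_ac)
qed

lemma integrality_gap_ge_half:
  assumes "k \<ge> 1" "m \<ge> 1" "(m + 1) ^ k \<le> n"
  shows "integrality_gap n k \<ge> ereal (real k / 2 - real k / (2 * (real m + 1)))"
proof -
  define s where "s = (k * m + 1) div 2"
  define q where "q = real (k * m)"
  let ?ratio = "2 * real s * (q + 1 - real s) / (q * (real m + 1))"
  have "k * m \<ge> 1" using assms(1,2) by simp
  then have s_bounds: "s > 0" "s \<le> k * m" unfolding s_def by linarith+
  have q_bounds: "q > 0" "q \<le> 2 * real s" "q / 2 \<le> q + 1 - real s"
    using \<open>k * m \<ge> 1\<close> unfolding q_def s_def by linarith+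
  have "real k / 2 - real k / (2 * (real m + 1)) = (q / 2) / (real m + 1)"
    by (simp add: q_def field_simps)
  also have "\<dots> = q * (q / 2) / (q * (real m + 1))" using q_bounds(1) by simp
  also have "\<dots> \<le> ?ratio"
    using q_bounds by (intro divide_right_mono mult_mono) auto
  finally have "ereal (real k / 2 - real k / (2 * (real m + 1))) \<le> ereal ?ratio"
    by (simp only: ereal_less_eq)
  also have "ereal ?ratio \<le> integrality_gap n k"
    unfolding q_def using s_bounds assms(3) by (rule integrality_gap_ge_threshold)
  finally show ?thesis .
qed

lemma add_one_power_le_of_mult_le_log:
  assumes "n > 0" "real (m * k) \<le> log 2 (real n)"
  shows "(m + 1) ^ k \<le> n"
proof -
  have "real (2 ^ (m * k)) = 2 powr real (m * k)" by (simp only: powr_realpow) simp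
  also have "\<dots> \<le> real n" using assms by (simp add: le_log_iff)
  finally have "2 ^ (m * k) \<le> n" by (simp only: of_nat_le_iff)
  moreover have "(m + 1) ^ k \<le> (2 ^ m) ^ k"
    using less_exp[of m] by (intro power_mono) (simp_all add: Suc_le_eq)
  ultimately show ?thesis by (simp add: power_mult)
qed

lemma divide_double_le_of_divide_le:
  fixes k l x :: real
  assumes "k \<ge> 2" "l > 0" "l / k \<le> x"
  shows "k / (2 * x) \<le> k * (k - 1) / l"
proof -
  have "l / k > 0" using assms(1,2) by simp
  then have "k / (2 * x) \<le> k / (2 * (l / k))"
    using assms by (intro frac_le) auto
  also have "\<dots> = k * (k / 2) / l" by simp
  also have "\<dots> \<le> k * (k - 1) / l"
    using assms(1,2) by (intro divide_right_mono mult_left_mono) auto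
  finally show ?thesis .
qed

theorem theorem3:
  fixes k n :: nat
  assumes "k \<ge> 2" and "n > 0" and "log 2 (real n) \<ge> real k"
  shows "integrality_gap n k \<ge>
           ereal (real k / 2 - real k * (real k - 1) / log 2 (real n))"
proof -
  define l where "l = log 2 (real n)"
  define m where "m = nat \<lfloor>l / real k\<rfloor>"
  have k_ge: "real k \<ge> 2" and "l \<ge> real k" using assms by (simp_all add: l_def)
  then have "l / real k \<ge> 1" by simp
  then have "m \<ge> 1" and m_le: "real m \<le> l / real k" and m_ge: "l / real k \<le> real m + 1"
    unfolding m_def by linarith+
  have "(m + 1) ^ k \<le> n"
    using m_le k_ge \<open>n > 0\<close>
    by (intro add_one_power_le_of_mult_le_log) (simp_all add: l_def field_simps)
  then have gap: "integrality_gap n k \<ge> ereal (real k / 2 - real k / (2 * (real m + 1)))"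
    using \<open>k \<ge> 2\<close> \<open>m \<ge> 1\<close> by (intro integrality_gap_ge_half) auto
  have "real k / (2 * (real m + 1)) \<le> real k * (real k - 1) / l"
    using k_ge m_ge \<open>l \<ge> real k\<close> by (intro divide_double_le_of_divide_le) auto
  then have "ereal (real k / 2 - real k * (real k - 1) / l)
      \<le> ereal (real k / 2 - real k / (2 * (real m + 1)))" by simp
  also note gap
  finally show ?thesis unfolding l_def .
qed

end
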